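(* Let $f:\{0,1\}^n\to\{0,1\}$ be a non-constant symmetric Boolean function over variables $V=\{x_1,\dots,x_n\}$ with spread $s$, and let $c:V\to\mathbb{R}^+$ be a cost function. Let $c_1\le c_2\le\cdots\le c_n$ be the variable costs sorted in non-decreasing order and $d_k=\sum_{i=1}^k c_i$. Then $$\gamma^f_c=\max_{n-s<k\le n}\left\{\frac{d_k}{d_{n-s}+c_k}\right\}.$$
   Context: $f$ is symmetric if its value is invariant under permutations of the variables; then $f(x)=\hat{\mathbf f}(\sum_i x_i)$ for a map $\hat{\mathbf f}:\{0,\dots,n\}\to\{0,1\}$. A block of $f$ is a maximal interval $[\ell,u]\subseteq\{0,\dots,n\}$ on which $\hat{\mathbf f}$ is constant; its width is $u-\ell+1$; the spread $s(f)$ is the maximum width of a block. Each variable $x$ has cost $c(x)$ paid to read its value; $c(U)=\sum_{x\in U}c(x)$. An assignment $\sigma$ gives each variable a value in $\{0,1\}$; a set $U$ is a proof of $f$ for $\sigma$ if the value of $f$ is determined by the values of $\sigma$ on $U$ and this holds for no proper subset of $U$. An evaluation algorithm $\mathbb{A}$ is a deterministic decision tree that adaptively reads variables until the variables read contain a proof; $c^f_{\mathbb{A}}(\sigma)$ is the total cost it pays on $\sigma$, and $c^f(\sigma)$ is the minimum cost of a proof for $\sigma$. $\gamma^{\mathbb{A}}_c(f)$ is the infimum of all $\rho$ with $c^f_{\mathbb{A}}(\sigma)\le\rho\,c^f(\sigma)$ for every $\sigma$, and $\gamma^f_c=\inf_{\mathbb{A}}\gamma^{\mathbb{A}}_c(f)$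 over all deterministic evaluation algorithms. *)

theory Defs
  imports Complex_Main "HOL-Library.Multiset" "HOL-Library.Cardinality"
begin

type_synonym 'v assignment = "'v \<Rightarrow> bool"

text \<open>Variables are indexed by a finite type \<open>'v\<close>, so that \<open>n\<close> is \<open>CARD('v)\<close>.\<close>

definition symmetric_fn :: "('v assignment \<Rightarrow> bool) \<Rightarrow> bool" where
  "symmetric_fn f \<longleftrightarrow> (\<forall>\<pi>. bij \<pi> \<longrightarrow> (\<forall>\<sigma>. f (\<sigma> \<circ> \<pi>) = f \<sigma>))"

text \<open>The map on \<open>{0..n}\<close> induced by a symmetric \<open>f\<close>; only meaningful for
  symmetric \<open>f\<close> and \<open>k \<le> n\<close>, where the described value exists and is unique.\<close>

definition value_map :: "('v assignment \<Rightarrow> bool) \<Rightarrow> nat \<Rightarrow> bool" where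
  "value_map f k = (THE b. \<forall>\<sigma>. card {x. \<sigma> x} = k \<longrightarrow> f \<sigma> = b)"

definition constant_interval :: "('v::finite assignment \<Rightarrow> bool) \<Rightarrow> nat \<Rightarrow> nat \<Rightarrow> bool" where
  "constant_interval f l u \<longleftrightarrow>
     l \<le> u \<and> u \<le> CARD('v) \<and> (\<forall>i\<in>{l..u}. \<forall>j\<in>{l..u}. value_map f i = value_map f j)"

definition block :: "('v::finite assignment \<Rightarrow> bool) \<Rightarrow> nat \<Rightarrow> nat \<Rightarrow> bool" where
  "block f l u \<longleftrightarrow> constant_interval f l u \<and>
     (\<forall>l' u'. constant_interval f l' u' \<and> {l..u} \<subseteq> {l'..u'} \<longrightarrow> {l'..u'} = {l..u})"

definition spread :: "('v::finite assignment \<Rightarrow> bool) \<Rightarrow> nat" where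
  "spread f = Max {u - l + 1 | l u. block f l u}"

definition cost :: "('v \<Rightarrow> real) \<Rightarrow> 'v set \<Rightarrow> real" where
  "cost c U = (\<Sum>x\<in>U. c x)"

definition determines :: "('v assignment \<Rightarrow> bool) \<Rightarrow> 'v assignment \<Rightarrow> 'v set \<Rightarrow> bool" where
  "determines f \<sigma> U \<longleftrightarrow> (\<forall>\<tau>. (\<forall>x\<in>U. \<tau> x = \<sigma> x) \<longrightarrow> f \<tau> = f \<sigma>)"

definition is_proof :: "('v assignment \<Rightarrow> bool) \<Rightarrow> 'v assignment \<Rightarrow> 'v set \<Rightarrow> bool" where
  "is_proof f \<sigma> U \<longleftrightarrow> determines f \<sigma> U \<and> (\<forall>U'. U' \<subset> U \<longrightarrow> \<not> determines f \<sigma> U')"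

definition min_proof_cost ::
    "('v::finite assignment \<Rightarrow> bool) \<Rightarrow> ('v \<Rightarrow> real) \<Rightarrow> 'v assignment \<Rightarrow> real" where
  "min_proof_cost f c \<sigma> = Min (cost c ` {U. is_proof f \<sigma> U})"

text \<open>In \<open>Query x t0 t1\<close> the tree reads \<open>x\<close> and continues with \<open>t1\<close> if its value is
  true and with \<open>t0\<close> otherwise. Leaves carry no output: when the tree stops, the
  variables read contain a proof, so the value of \<open>f\<close> is known.\<close>

datatype 'v dtree = Stop | Query 'v "'v dtree" "'v dtree"

primrec reads :: "'v dtree \<Rightarrow> 'v assignment \<Rightarrow> 'v list" where
  "reads Stop \<sigma> = []"
| "reads (Query x t0 t1) \<sigma> = x # (if \<sigma> x then reads t1 \<sigma> else reads t0 \<sigma>)"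

definition contains_proof :: "('v assignment \<Rightarrow> bool) \<Rightarrow> 'v assignment \<Rightarrow> 'v set \<Rightarrow> bool" where
  "contains_proof f \<sigma> R \<longleftrightarrow> (\<exists>U\<subseteq>R. is_proof f \<sigma> U)"

text \<open>No variable is read twice, and reading stops at the first moment at which the
  variables read contain a proof.\<close>

definition evaluation_algorithm :: "('v assignment \<Rightarrow> bool) \<Rightarrow> 'v dtree \<Rightarrow> bool" where
  "evaluation_algorithm f A \<longleftrightarrow>
     (\<forall>\<sigma>. distinct (reads A \<sigma>) \<and>
          contains_proof f \<sigma> (set (reads A \<sigma>)) \<and>
          (\<forall>k<length (reads A \<sigma>). \<not> contains_proof f \<sigma> (set (take k (reads A \<sigma>)))))"

definition algorithm_cost :: "('v \<Rightarrow> real) \<Rightarrow> 'v dtree \<Rightarrow> 'v assignment \<Rightarrow> real" where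
  "algorithm_cost c A \<sigma> = cost c (set (reads A \<sigma>))"

definition algorithm_ratio ::
    "('v::finite assignment \<Rightarrow> bool) \<Rightarrow> ('v \<Rightarrow> real) \<Rightarrow> 'v dtree \<Rightarrow> real" where
  "algorithm_ratio f c A = Inf {\<rho>. \<forall>\<sigma>. algorithm_cost c A \<sigma> \<le> \<rho> * min_proof_cost f c \<sigma>}"

definition competitive_ratio ::
    "('v::finite assignment \<Rightarrow> bool) \<Rightarrow> ('v \<Rightarrow> real) \<Rightarrow> real" where
  "competitive_ratio f c = (INF A\<in>{A. evaluation_algorithm f A}. algorithm_ratio f c A)"

text \<open>\<open>sorted_cost c k\<close> is the \<open>k\<close>-th smallest cost for \<open>1 \<le> k \<le> n\<close>, counted with
  multiplicity.\<close>

definition sorted_cost :: "('v::finite \<Rightarrow> real) \<Rightarrow> nat \<Rightarrow> real" where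
  "sorted_cost c k = sorted_list_of_multiset (image_mset c (mset_set UNIV)) ! (k - 1)"

definition prefix_cost :: "('v::finite \<Rightarrow> real) \<Rightarrow> nat \<Rightarrow> real" where
  "prefix_cost c k = (\<Sum>i=1..k. sorted_cost c i)"

end

theory Submission
  imports Defs
begin

text \<open>Inside a block \<open>[l, u]\<close> a set is a certificate iff it contains \<open>l\<close> ones and \<open>n - u\<close> zeros, so
  every proof has at least \<open>n - s + 1\<close> elements.

  Upper bound: read the variables by non-decreasing cost. If reading stops after \<open>k\<close> variables,
  any proof contains a variable outside the \<open>k - 1\<close> cheapest ones, of cost at least \<open>c\<^sub>k\<close>, and at
  least \<open>n - s\<close> further variables.

  Lower bound: for each \<open>k\<close> with \<open>n - s < k \<le> n\<close>, an adversary working in a block of maximal width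
  forces every algorithm to read all of the \<open>k\<close> cheapest variables although the \<open>n - s\<close> cheapest
  ones, together with one of the next \<open>k - (n - s)\<close>, form a proof.\<close>

section \<open>Symmetric functions and their blocks\<close>

text \<open>A bijection between the two sets of ones and one between the two sets of zeros glue to a
  permutation \<open>p\<close> with \<open>\<sigma> \<circ> p = \<tau>\<close>.\<close>

lemma symmetric_fn_eq_card:
  fixes \<sigma> \<tau> :: "'v::finite assignment"
  assumes "symmetric_fn f" "card {x. \<sigma> x} = card {x. \<tau> x}"
  shows "f \<sigma> = f \<tau>"
proof -
  obtain g where g: "bij_betw g {x. \<tau> x} {x. \<sigma> x}"
    using assms(2) by (metis finite finite_same_card_bij)
  have "card (- {x. \<tau> x}) = card (- {x. \<sigma> x})"
    using assms(2) by (simp add: Compl_eq_Diff_UNIV card_Diff_subset)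
  then obtain h where h: "bij_betw h (- {x. \<tau> x}) (- {x. \<sigma> x})"
    by (metis finite finite_same_card_bij)
  define p where "p x = (if \<tau> x then g x else h x)" for x
  have "bij_betw p ({x. \<tau> x} \<union> - {x. \<tau> x}) ({x. \<sigma> x} \<union> - {x. \<sigma> x})"
  proof (rule bij_betw_combine)
    show "bij_betw p {x. \<tau> x} {x. \<sigma> x}"
      using g by (rule bij_betw_cong[THEN iffD1, rotated]) (simp add: p_def)
    show "bij_betw p (- {x. \<tau> x}) (- {x. \<sigma> x})"
      using h by (rule bij_betw_cong[THEN iffD1, rotated]) (simp add: p_def)
  qed auto
  then have "bij p" by (simp add: Compl_partition)
  moreover have "\<sigma> \<circ> p = \<tau>"
  proof
    fix x
    show "(\<sigma> \<circ> p) x = \<tau> x"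
      using bij_betwE[OF g] bij_betwE[OF h] by (cases "\<tau> x") (auto simp: p_def)
  qed
  ultimately show ?thesis
    using assms(1) unfolding symmetric_fn_def by metis
qed

lemma value_map_card:
  fixes \<sigma> :: "'v::finite assignment"
  assumes "symmetric_fn f"
  shows "value_map f (card {x. \<sigma> x}) = f \<sigma>"
  unfolding value_map_def
  using symmetric_fn_eq_card[OF assms] by (intro the_equality) (metis, metis)

text \<open>Maximality enters through the two neighbours: if \<open>l - 1\<close> or
  \<open>Suc u\<close> had the value of the block, the interval could be extended by that
  point.\<close>

lemma blockD:
  fixes f :: "'v::finite assignment \<Rightarrow> bool"
  assumes "block f l u"
  shows "l \<le> u" "u \<le> CARD('v)"
    and "\<And>i j. i \<in> {l..u} \<Longrightarrow> j \<in> {l..u} \<Longrightarrow> value_map f i = value_map f j"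
    and "0 < l \<Longrightarrow> i \<in> {l..u} \<Longrightarrow> value_map f (l - 1) \<noteq> value_map f i"
    and "u < CARD('v) \<Longrightarrow> i \<in> {l..u} \<Longrightarrow> value_map f (Suc u) \<noteq> value_map f i"
proof -
  have ci: "constant_interval f l u"
    and mx: "\<And>l' u'. constant_interval f l' u' \<Longrightarrow> {l..u} \<subseteq> {l'..u'} \<Longrightarrow> {l'..u'} = {l..u}"
    using assms unfolding block_def by blast+
  show lu: "l \<le> u" and un: "u \<le> CARD('v)"
    and const: "\<And>i j. i \<in> {l..u} \<Longrightarrow> j \<in> {l..u} \<Longrightarrow> value_map f i = value_map f j"
    using ci unfolding constant_interval_def by blast+
  show "value_map f (l - 1) \<noteq> value_map f i" if "0 < l" "i \<in> {l..u}"
  proof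
    assume eq: "value_map f (l - 1) = value_map f i"
    have "value_map f j = value_map f i" if "j \<in> {l - 1..u}" for j
    proof (cases "j = l - 1")
      case False
      then have "j \<in> {l..u}" using that by auto
      then show ?thesis using const \<open>i \<in> {l..u}\<close> by blast
    qed (use eq in simp)
    then have "constant_interval f (l - 1) u"
      using lu un unfolding constant_interval_def by simp
    from mx[OF this] have "{l - 1..u} = {l..u}" by auto
    then show False using \<open>0 < l\<close> lu by (simp add: Icc_eq_Icc)
  qed
  show "value_map f (Suc u) \<noteq> value_map f i" if "u < CARD('v)" "i \<in> {l..u}"
  proof
    assume eq: "value_map f (Suc u) = value_map f i"
    have "value_map f j = value_map f i" if "j \<in> {l..Suc u}" for j
    proof (cases "j = Suc u")
      case False
      then have "j \<in> {l..u}" using that by auto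
      then show ?thesis using const \<open>i \<in> {l..u}\<close> by blast
    qed (use eq in simp)
    then have "constant_interval f l (Suc u)"
      using lu \<open>u < CARD('v)\<close> unfolding constant_interval_def by simp
    from mx[OF this] have "{l..Suc u} = {l..u}" by auto
    then show False using lu by (simp add: Icc_eq_Icc)
  qed
qed

text \<open>Among the finitely many constant intervals through \<open>k\<close>, one of greatest
  width is maximal for inclusion, because every interval containing it also contains
  \<open>k\<close>.\<close>

lemma ex_block:
  fixes f :: "'v::finite assignment \<Rightarrow> bool"
  assumes "k \<le> CARD('v)"
  obtains l u where "block f l u" "k \<in> {l..u}"
proof -
  define I where "I = {(l, u). constant_interval f l u \<and> k \<in> {l..u}}"
  have "I \<subseteq> {..CARD('v)} \<times> {..CARD('v)}"
    unfolding I_def constant_interval_def by auto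
  then have fin: "finite I" by (rule finite_subset) simp
  have "constant_interval f k k" using assms unfolding constant_interval_def by simp
  then have ne: "I \<noteq> {}" unfolding I_def by force
  let ?w = "\<lambda>q. snd q - fst q"
  have "Max (?w ` I) \<in> ?w ` I" using fin ne by (intro Max_in) auto
  then obtain p where p: "p \<in> I" "?w p = Max (?w ` I)" by auto
  have mx: "\<forall>q\<in>I. ?w q \<le> ?w p" unfolding p(2) using fin by (auto intro: Max_ge)
  obtain l u where lu: "p = (l, u)" by force
  have 1: "constant_interval f l u" "k \<in> {l..u}" using p(1) lu unfolding I_def by auto
  have "{l'..u'} = {l..u}" if "constant_interval f l' u'" "{l..u} \<subseteq> {l'..u'}" for l' u'
  proof -
    have "l' \<le> l" "u \<le> u'" using that(2) 1(2) by (auto simp: atLeastatMost_subset_iff)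
    moreover have "(l', u') \<in> I" using that 1(2) unfolding I_def by auto
    then have "u' - l' \<le> u - l" using mx lu by force
    ultimately show ?thesis using 1(2) by auto
  qed
  then have "block f l u" using 1 unfolding block_def by blast
  then show ?thesis using 1 that by blast
qed

lemma finite_block_widths:
  fixes f :: "'v::finite assignment \<Rightarrow> bool"
  shows "finite {u - l + 1 | l u. block f l u}"
proof (rule finite_subset)
  show "{u - l + 1 | l u. block f l u} \<subseteq> {..CARD('v) + 1}"
    using blockD(1,2) by fastforce
qed simp

lemma block_width_le_spread:
  fixes f :: "'v::finite assignment \<Rightarrow> bool"
  assumes "block f l u"
  shows "u - l + 1 \<le> spread f"
  unfolding spread_def using finite_block_widths assms by (intro Max_ge) auto

lemma ex_block_spread:
  fixes f :: "'v::finite assignment \<Rightarrow> bool"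
  obtains l u where "block f l u" "u - l + 1 = spread f"
proof -
  obtain l u where "block f l u" by (rule ex_block[of 0 f]) auto
  then have "{u - l + 1 | l u. block f l u} \<noteq> {}" by blast
  from Max_in[OF finite_block_widths this] show ?thesis
    using that unfolding spread_def[symmetric] by fastforce
qed

text \<open>A block of width n + 1 would be all of {0..n} and make \<open>f\<close> constant. Hence
  s \<le> n, and the natural-number difference n - s is not truncated.\<close>

lemma block_width_le_card:
  fixes f :: "'v::finite assignment \<Rightarrow> bool"
  assumes "symmetric_fn f" "\<exists>\<sigma> \<tau>. f \<sigma> \<noteq> f \<tau>" "block f l u"
  shows "u - l + 1 \<le> CARD('v)"
proof (rule ccontr)
  assume "\<not> ?thesis"
  then have lu: "l = 0" "u = CARD('v)" using blockD(1,2)[OF assms(3)] by auto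
  have "f \<sigma> = f \<tau>" for \<sigma> \<tau>
  proof -
    have "card {x. \<sigma> x} \<le> CARD('v)" "card {x. \<tau> x} \<le> CARD('v)"
      by (auto intro: card_mono)
    then show ?thesis
      using blockD(3)[OF assms(3)] value_map_card[OF assms(1)] lu
      by (metis atLeastAtMost_iff zero_le)
  qed
  then show False using assms(2) by blast
qed

section \<open>Proofs\<close>

lemma determines_mono: "determines f \<sigma> U \<Longrightarrow> U \<subseteq> U' \<Longrightarrow> determines f \<sigma> U'"
  unfolding determines_def by blast

lemma determines_UNIV: "determines f \<sigma> UNIV"
  unfolding determines_def by (simp flip: fun_eq_iff)

text \<open>By finiteness a determining set contains an inclusion-minimal one, so from here on the
  minimality of proofs can mostly be ignored.\<close>

lemma contains_proof_iff_determines: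
  fixes \<sigma> :: "'v::finite assignment"
  shows "contains_proof f \<sigma> R \<longleftrightarrow> determines f \<sigma> R"
proof
  assume "contains_proof f \<sigma> R"
  then obtain U where "U \<subseteq> R" "determines f \<sigma> U"
    unfolding contains_proof_def is_proof_def by auto
  then show "determines f \<sigma> R" by (auto intro: determines_mono)
next
  assume "determines f \<sigma> R"
  then have "finite {U. U \<subseteq> R \<and> determines f \<sigma> U}" "R \<in> {U. U \<subseteq> R \<and> determines f \<sigma> U}"
    by auto
  from finite_has_minimal2[OF this] obtain U where
    U: "U \<subseteq> R" "determines f \<sigma> U" and
    "\<forall>U'\<in>{U. U \<subseteq> R \<and> determines f \<sigma> U}. U' \<subseteq> U \<longrightarrow> U = U'"
    by auto
  then have "\<not> determines f \<sigma> U'" if "U' \<subset> U" for U' using that by blast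
  then show "contains_proof f \<sigma> R"
    using U unfolding contains_proof_def is_proof_def by blast
qed

lemma determines_iff_counts:
  fixes f :: "'v::finite assignment \<Rightarrow> bool"
  assumes sym: "symmetric_fn f" and bl: "block f l u" and \<sigma>: "card {x. \<sigma> x} \<in> {l..u}"
  shows "determines f \<sigma> R \<longleftrightarrow>
    l \<le> card {x \<in> R. \<sigma> x} \<and> CARD('v) - u \<le> card {x \<in> R. \<not> \<sigma> x}"
proof (intro iffI conjI)
  assume det: "determines f \<sigma> R"
  show "l \<le> card {x \<in> R. \<sigma> x}"
  proof (rule ccontr)
    assume *: "\<not> ?thesis"
    \<comment> \<open>Switching ones outside \<open>R\<close> to 0 leads to weight
      \<open>l - 1\<close>, just below the block, without changing anything on \<open>R\<close>. The
      case of too few zeros raises the weight to \<open>Suc u\<close> instead.\<close>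
    have "\<exists>T. {x \<in> R. \<sigma> x} \<subseteq> T \<and> T \<subseteq> {x. \<sigma> x} \<and> card T = l - 1"
      using * \<sigma> by (intro exists_subset_between) auto
    then obtain T where T: "{x \<in> R. \<sigma> x} \<subseteq> T" "T \<subseteq> {x. \<sigma> x}" "card T = l - 1" by blast
    have "f (\<lambda>x. x \<in> T) = f \<sigma>"
      using T by (intro det[unfolded determines_def, rule_format]) auto
    then have "value_map f (l - 1) = value_map f (card {x. \<sigma> x})"
      using value_map_card[OF sym, of "\<lambda>x. x \<in> T"] value_map_card[OF sym, of \<sigma>] T(3) by simp
    then show False using blockD(4)[OF bl _ \<sigma>] * by auto
  qed
  show "CARD('v) - u \<le> card {x \<in> R. \<not> \<sigma> x}"
  proof (rule ccontr)
    assume *: "\<not> ?thesis"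
    have c: "card (- {x \<in> R. \<not> \<sigma> x}) = CARD('v) - card {x \<in> R. \<not> \<sigma> x}"
      by (simp add: Compl_eq_Diff_UNIV card_Diff_subset)
    have "\<exists>T. {x. \<sigma> x} \<subseteq> T \<and> T \<subseteq> - {x \<in> R. \<not> \<sigma> x} \<and> card T = Suc u"
      using * \<sigma> c by (intro exists_subset_between) auto
    then obtain T where T: "{x. \<sigma> x} \<subseteq> T" "T \<subseteq> - {x \<in> R. \<not> \<sigma> x}" "card T = Suc u" by blast
    have "f (\<lambda>x. x \<in> T) = f \<sigma>"
      using T by (intro det[unfolded determines_def, rule_format]) auto
    then have "value_map f (Suc u) = value_map f (card {x. \<sigma> x})"
      using value_map_card[OF sym, of "\<lambda>x. x \<in> T"] value_map_card[OF sym, of \<sigma>] T(3) by simp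
    then show False using blockD(5)[OF bl _ \<sigma>] * by auto
  qed
next
  assume *: "l \<le> card {x \<in> R. \<sigma> x} \<and> CARD('v) - u \<le> card {x \<in> R. \<not> \<sigma> x}"
  show "determines f \<sigma> R"
    unfolding determines_def
  proof (intro allI impI)
    fix \<tau> assume eq: "\<forall>x\<in>R. \<tau> x = \<sigma> x"
    \<comment> \<open>The ones and zeros already fixed on \<open>R\<close> confine the weight of
      \<open>\<tau>\<close> to the block.\<close>
    have "card {x \<in> R. \<sigma> x} \<le> card {x. \<tau> x}"
      using eq by (intro card_mono) auto
    moreover have "card {x \<in> R. \<not> \<sigma> x} \<le> card (- {x. \<tau> x})"
      using eq by (intro card_mono) auto
    then have "card {x \<in> R. \<not> \<sigma> x} \<le> CARD('v) - card {x. \<tau> x}" by (simp add: Compl_eq_Diff_UNIV card_Diff_subset)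
    moreover have "card {x. \<tau> x} \<le> CARD('v)" by (auto intro: card_mono)
    ultimately have "card {x. \<tau> x} \<in> {l..u}" using * blockD(2)[OF bl] by auto
    then show "f \<tau> = f \<sigma>"
      using blockD(3)[OF bl _ \<sigma>] value_map_card[OF sym] by metis
  qed
qed

lemma card_determines:
  fixes f :: "'v::finite assignment \<Rightarrow> bool"
  assumes sym: "symmetric_fn f" and nonconst: "\<exists>\<sigma> \<tau>. f \<sigma> \<noteq> f \<tau>"
    and det: "determines f \<sigma> R"
  shows "CARD('v) - spread f < card R"
proof -
  have "card {x. \<sigma> x} \<le> CARD('v)" by (auto intro: card_mono)
  then obtain l u where bl: "block f l u" and \<sigma>: "card {x. \<sigma> x} \<in> {l..u}"
    by (rule ex_block)
  have "card R = card ({x \<in> R. \<sigma> x} \<union> {x \<in> R. \<not> \<sigma> x})" by (rule arg_cong[of _ _ card]) auto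
  also have "\<dots> = card {x \<in> R. \<sigma> x} + card {x \<in> R. \<not> \<sigma> x}"
    by (intro card_Un_disjoint) auto
  finally show ?thesis
    using determines_iff_counts[OF sym bl \<sigma>] det block_width_le_spread[OF bl] blockD(1,2)[OF bl]
      block_width_le_card[OF sym nonconst bl]
    by auto
qed

text \<open>Any determining set serves as an upper bound: positive costs mean that shrinking it to a
  proof cannot raise its cost.\<close>

lemma min_proof_cost_le:
  fixes c :: "'v::finite \<Rightarrow> real"
  assumes "determines f \<sigma> U" "\<And>x. c x > 0"
  shows "min_proof_cost f c \<sigma> \<le> cost c U"
proof -
  obtain U' where U': "U' \<subseteq> U" "is_proof f \<sigma> U'"
    using assms(1) contains_proof_iff_determines unfolding contains_proof_def by blast
  have "min_proof_cost f c \<sigma> \<le> cost c U'"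
    unfolding min_proof_cost_def using U' by (intro Min_le) auto
  also have "\<dots> \<le> cost c U"
    unfolding cost_def using U' assms(2) by (intro sum_mono2) (auto intro: less_imp_le)
  finally show ?thesis .
qed

lemma min_proof_cost_obtain:
  fixes c :: "'v::finite \<Rightarrow> real"
  obtains U where "determines f \<sigma> U" "min_proof_cost f c \<sigma> = cost c U"
proof -
  have "determines f \<sigma> UNIV" by (rule determines_UNIV)
  then have "{U. is_proof f \<sigma> U} \<noteq> {}"
    using contains_proof_iff_determines unfolding contains_proof_def by blast
  then have "min_proof_cost f c \<sigma> \<in> cost c ` {U. is_proof f \<sigma> U}"
    unfolding min_proof_cost_def by (intro Min_in) auto
  then show ?thesis using that unfolding is_proof_def by auto
qed

lemma min_proof_cost_pos:
  fixes f :: "'v::finite assignment \<Rightarrow> bool"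
  assumes "symmetric_fn f" "\<exists>\<sigma> \<tau>. f \<sigma> \<noteq> f \<tau>" "\<And>x. c x > 0"
  shows "0 < min_proof_cost f c \<sigma>"
proof -
  obtain U where U: "determines f \<sigma> U" "min_proof_cost f c \<sigma> = cost c U"
    by (rule min_proof_cost_obtain)
  then have "U \<noteq> {}" using card_determines[OF assms(1,2) U(1)] by auto
  then show ?thesis using U assms(3) unfolding cost_def by (auto intro: sum_pos)
qed

section \<open>Cheapest variables\<close>

text \<open>\<open>sorted_cost\<close> sees only the multiset of costs; such a listing names
  variables attaining them, which both bounds need.\<close>

lemma ex_sorted_listing:
  fixes c :: "'v::finite \<Rightarrow> real"
  obtains S where "distinct S" "set S = UNIV" "sorted (map c S)"
proof -
  obtain xs :: "'v list" where "set xs = UNIV" "distinct xs"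
    using finite_distinct_list[of "UNIV :: 'v set"] by auto
  then show ?thesis using that[of "sort_key c xs"] by simp
qed

lemma length_listing: "distinct S \<Longrightarrow> set S = UNIV \<Longrightarrow> length S = CARD('v)" for S :: "'v list"
  by (metis distinct_card)

lemma sorted_cost_nth:
  fixes c :: "'v::finite \<Rightarrow> real"
  assumes "distinct S" "set S = UNIV" "sorted (map c S)" "k \<in> {1..CARD('v)}"
  shows "sorted_cost c k = c (S ! (k - 1))"
proof -
  have "mset_set UNIV = mset S" using assms(1,2) by (metis mset_set_set)
  then have "image_mset c (mset_set UNIV) = mset (map c S)" by simp
  then have "sorted_list_of_multiset (image_mset c (mset_set UNIV)) = map c S"
    using assms(3) by (metis sorted_list_of_multiset_mset sorted_sort_id)
  then show ?thesis
    using assms(4) length_listing[OF assms(1,2)] unfolding sorted_cost_def by auto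
qed

lemma prefix_cost_take:
  fixes c :: "'v::finite \<Rightarrow> real"
  assumes "distinct S" "set S = UNIV" "sorted (map c S)" "k \<le> CARD('v)"
  shows "prefix_cost c k = cost c (set (take k S))"
  using assms(4)
proof (induction k)
  case (Suc k)
  then have k: "k < length S" using length_listing[OF assms(1,2)] by simp
  have "S ! k \<notin> set (take k S)"
    using assms(1) k by (metis take_Suc_conv_app_nth distinct_take not_distinct_conv_prefix)
  then have "cost c (set (take (Suc k) S)) = c (S ! k) + cost c (set (take k S))"
    using k by (simp add: take_Suc_conv_app_nth cost_def)
  moreover have "sorted_cost c (Suc k) = c (S ! k)"
    using sorted_cost_nth[OF assms(1-3), of "Suc k"] Suc.prems by simp
  ultimately show ?case using Suc by (simp add: prefix_cost_def)
qed (simp add: prefix_cost_def cost_def)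

lemma sorted_listing_le:
  assumes "sorted (map c S)" "k < length S"
  shows "x \<in> set (take (Suc k) S) \<Longrightarrow> c x \<le> c (S ! k)"
    and "x \<in> set (drop k S) \<Longrightarrow> c (S ! k) \<le> c x"
proof -
  have le: "c (S ! i) \<le> c (S ! j)" if "i \<le> j" "j < length S" for i j
    using sorted_nth_mono[OF assms(1), of i j] that by simp
  show "x \<in> set (take (Suc k) S) \<Longrightarrow> c x \<le> c (S ! k)"
    using le assms(2) by (auto simp: in_set_conv_nth)
  show "x \<in> set (drop k S) \<Longrightarrow> c (S ! k) \<le> c x"
    using le assms(2) by (auto simp: in_set_conv_nth)
qed

text \<open>Exchange argument: the cost \<open>t\<close> of the last of the \<open>m\<close>
  cheapest variables separates \<open>T\<close> from the rest, and \<open>U - T\<close> has at least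
  as many elements as \<open>T - U\<close>.\<close>

lemma prefix_cost_le_cost:
  fixes c :: "'v::finite \<Rightarrow> real"
  assumes pos: "\<And>x. c x > 0" and "m \<le> card U"
  shows "prefix_cost c m \<le> cost c U"
proof (cases m)
  case 0
  then show ?thesis
    using pos by (simp add: prefix_cost_def cost_def sum_nonneg less_imp_le)
next
  case (Suc j)
  obtain S where S: "distinct S" "set S = UNIV" "sorted (map c S)"
    by (rule ex_sorted_listing)
  have "card U \<le> CARD('v)" by (auto intro: card_mono)
  then have m: "m \<le> CARD('v)" using assms(2) by simp
  then have j: "j < length S" using Suc length_listing[OF S(1,2)] by simp
  define T where "T = set (take m S)"
  define t where "t = c (S ! j)"
  have lo: "c x \<le> t" if "x \<in> T" for x
    using sorted_listing_le(1)[OF S(3) j] that Suc unfolding T_def t_def by blast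
  have hi: "t \<le> c x" if "x \<notin> T" for x
  proof -
    have "x \<in> set (take m S @ drop m S)" using S(2) by simp
    then have "x \<in> set (drop m S)" using that unfolding T_def set_append by blast
    then have "x \<in> set (drop j S)" using Suc set_drop_subset_set_drop[of j m S] by auto
    then show ?thesis using sorted_listing_le(2)[OF S(3) j] unfolding t_def by blast
  qed
  have "card T = m"
    using S(1) m length_listing[OF S(1,2)] unfolding T_def by (simp add: distinct_card)
  then have cd: "card (T - U) \<le> card (U - T)"
    using assms(2) card_le_sym_Diff[of T U] by simp
  have "cost c (T - U) \<le> real (card (T - U)) * t"
    unfolding cost_def using lo by (intro sum_bounded_above) auto
  also have "\<dots> \<le> real (card (U - T)) * t"
    using cd pos[of "S ! j"] unfolding t_def by (intro mult_right_mono) auto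
  also have "\<dots> \<le> cost c (U - T)"
    unfolding cost_def using hi by (intro sum_bounded_below) auto
  finally have "cost c (T \<inter> U) + cost c (T - U) \<le> cost c (T \<inter> U) + cost c (U - T)" by simp
  moreover have "cost c T = cost c (T \<inter> U) + cost c (T - U)"
    unfolding cost_def by (rule sum.Int_Diff) simp
  moreover have "cost c U = cost c (T \<inter> U) + cost c (U - T)"
    unfolding cost_def using sum.Int_Diff[of U c T] by (simp add: Int_commute)
  ultimately show ?thesis
    using prefix_cost_take[OF S m] unfolding T_def by simp
qed

section \<open>Reading in a fixed order\<close>

text \<open>\<open>R\<close> is the set of variables already read and \<open>\<tau>\<close> records their values.\<close>

primrec fixed_order_tree ::
    "('v assignment \<Rightarrow> bool) \<Rightarrow> 'v list \<Rightarrow> 'v set \<Rightarrow> 'v assignment \<Rightarrow> 'v dtree" where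
  "fixed_order_tree f [] R \<tau> = Stop"
| "fixed_order_tree f (x # xs) R \<tau> =
    (if determines f \<tau> R then Stop
     else Query x (fixed_order_tree f xs (insert x R) (\<tau>(x := False)))
                  (fixed_order_tree f xs (insert x R) (\<tau>(x := True))))"

text \<open>This lets the tree decide its stopping test from the recorded values alone.\<close>

lemma determines_cong:
  assumes "\<And>x. x \<in> R \<Longrightarrow> \<tau> x = \<sigma> x"
  shows "determines f \<tau> R \<longleftrightarrow> determines f \<sigma> R"
  using assms unfolding determines_def by metis

text \<open>The recorded \<open>\<tau>\<close> agrees with \<open>\<sigma>\<close> on
  \<open>R\<close> throughout, so the tree stops at the shortest prefix that settles
  \<open>f\<close>.\<close>

lemma reads_fixed_order_tree:
  assumes "\<And>x. x \<in> R \<Longrightarrow> \<tau> x = \<sigma> x" "determines f \<sigma> (R \<union> set xs)"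
  shows "\<exists>m\<le>length xs. reads (fixed_order_tree f xs R \<tau>) \<sigma> = take m xs \<and>
    determines f \<sigma> (R \<union> set (take m xs)) \<and>
    (\<forall>k<m. \<not> determines f \<sigma> (R \<union> set (take k xs)))"
  using assms
proof (induction xs arbitrary: R \<tau>)
  case (Cons x xs)
  show ?case
  proof (cases "determines f \<sigma> R")
    case True
    then show ?thesis
      using determines_cong[of R \<tau> \<sigma> f] Cons.prems(1) by (intro exI[of _ 0]) auto
  next
    case False
    then have nd: "\<not> determines f \<tau> R"
      using determines_cong[of R \<tau> \<sigma> f] Cons.prems(1) by auto
    have "\<And>y. y \<in> insert x R \<Longrightarrow> (\<tau>(x := \<sigma> x)) y = \<sigma> y" using Cons.prems(1) by auto
    moreover have "determines f \<sigma> (insert x R \<union> set xs)" using Cons.prems(2) by simp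
    ultimately obtain m where m: "m \<le> length xs"
      "reads (fixed_order_tree f xs (insert x R) (\<tau>(x := \<sigma> x))) \<sigma> = take m xs"
      "determines f \<sigma> (insert x R \<union> set (take m xs))"
      "\<forall>k<m. \<not> determines f \<sigma> (insert x R \<union> set (take k xs))"
      using Cons.IH by blast
    have "reads (fixed_order_tree f (x # xs) R \<tau>) \<sigma> = x # take m xs"
      using nd m(2) by (cases "\<sigma> x") auto
    moreover have "\<not> determines f \<sigma> (R \<union> set (take k (x # xs)))" if "k < Suc m" for k
      using that m(4) False by (cases k) auto
    ultimately show ?thesis
      using m(1,3) by (intro exI[of _ "Suc m"]) auto
  qed
qed simp

lemma reads_fixed_order_tree_listing:
  fixes f :: "'v::finite assignment \<Rightarrow> bool"
  assumes "set S = UNIV"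
  obtains m where "m \<le> length S" "reads (fixed_order_tree f S {} \<tau>) \<sigma> = take m S"
    "determines f \<sigma> (set (take m S))" "\<And>k. k < m \<Longrightarrow> \<not> determines f \<sigma> (set (take k S))"
proof -
  have "determines f \<sigma> ({} \<union> set S)" using assms determines_UNIV by simp
  then obtain m where "m \<le> length S" "reads (fixed_order_tree f S {} \<tau>) \<sigma> = take m S"
    "determines f \<sigma> (set (take m S))" "\<forall>k<m. \<not> determines f \<sigma> (set (take k S))"
    using reads_fixed_order_tree[of "{}" \<tau> \<sigma> f S] by auto
  then show ?thesis using that by blast
qed

lemma evaluation_algorithm_fixed_order_tree:
  fixes f :: "'v::finite assignment \<Rightarrow> bool"
  assumes "distinct S" "set S = UNIV"
  shows "evaluation_algorithm f (fixed_order_tree f S {} \<tau>)"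
  unfolding evaluation_algorithm_def contains_proof_iff_determines
proof
  fix \<sigma>
  obtain m where "m \<le> length S" "reads (fixed_order_tree f S {} \<tau>) \<sigma> = take m S"
    "determines f \<sigma> (set (take m S))" "\<And>k. k < m \<Longrightarrow> \<not> determines f \<sigma> (set (take k S))"
    by (rule reads_fixed_order_tree_listing[OF assms(2)]) blast
  then show "distinct (reads (fixed_order_tree f S {} \<tau>) \<sigma>) \<and>
    determines f \<sigma> (set (reads (fixed_order_tree f S {} \<tau>) \<sigma>)) \<and>
    (\<forall>k<length (reads (fixed_order_tree f S {} \<tau>) \<sigma>).
      \<not> determines f \<sigma> (set (take k (reads (fixed_order_tree f S {} \<tau>) \<sigma>))))"
    using assms(1) by (simp add: min_def)
qed

lemma sorted_order_cost:
  fixes f :: "'v::finite assignment \<Rightarrow> bool"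
  assumes sym: "symmetric_fn f" and nonconst: "\<exists>\<sigma> \<tau>. f \<sigma> \<noteq> f \<tau>"
    and pos: "\<And>x. c x > 0"
    and S: "distinct S" "set S = UNIV" "sorted (map c S)"
  obtains k where "k \<in> {CARD('v) - spread f<..CARD('v)}"
    "algorithm_cost c (fixed_order_tree f S {} \<tau>) \<sigma> = prefix_cost c k"
    "prefix_cost c (CARD('v) - spread f) + sorted_cost c k \<le> min_proof_cost f c \<sigma>"
proof -
  obtain k where k: "k \<le> length S" "reads (fixed_order_tree f S {} \<tau>) \<sigma> = take k S"
    "determines f \<sigma> (set (take k S))" "\<And>j. j < k \<Longrightarrow> \<not> determines f \<sigma> (set (take j S))"
    by (rule reads_fixed_order_tree_listing[OF S(2)]) blast
  have kn: "k \<le> CARD('v)" using k(1) length_listing[OF S(1,2)] by simp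
  have "card (set (take k S)) = k" using S(1) k(1) by (simp add: distinct_card)
  then have ks: "CARD('v) - spread f < k" using card_determines[OF sym nonconst k(3)] by simp
  obtain U where U: "determines f \<sigma> U" "min_proof_cost f c \<sigma> = cost c U"
    by (rule min_proof_cost_obtain)
  \<comment> \<open>Reading did not stop after \<open>k - 1\<close> variables, so the cheapest proof
    \<open>U\<close> needs a variable \<open>y\<close> beyond them.\<close>
  have "\<not> U \<subseteq> set (take (k - 1) S)"
    using k(4)[of "k - 1"] ks determines_mono[OF U(1)] by auto
  then obtain y where y: "y \<in> U" "y \<notin> set (take (k - 1) S)" by blast
  have "y \<in> set (take (k - 1) S @ drop (k - 1) S)" using S(2) by simp
  then have "y \<in> set (drop (k - 1) S)" using y(2) unfolding set_append by blast
  then have "c (S ! (k - 1)) \<le> c y"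
    using sorted_listing_le(2)[OF S(3)] k(1) ks by simp
  then have cy: "sorted_cost c k \<le> c y"
    using sorted_cost_nth[OF S, of k] ks kn by simp
  \<comment> \<open>\<open>U\<close> has more than n - s elements, so n - s remain once
    \<open>y\<close> is charged separately.\<close>
  have "CARD('v) - spread f \<le> card (U - {y})"
    using card_determines[OF sym nonconst U(1)] y(1) by simp
  then have "prefix_cost c (CARD('v) - spread f) \<le> cost c (U - {y})"
    by (intro prefix_cost_le_cost pos)
  moreover have "cost c U = c y + cost c (U - {y})"
    unfolding cost_def using y(1) by (simp add: sum.remove)
  ultimately have "prefix_cost c (CARD('v) - spread f) + sorted_cost c k \<le> min_proof_cost f c \<sigma>"
    using cy U(2) by simp
  moreover have "algorithm_cost c (fixed_order_tree f S {} \<tau>) \<sigma> = prefix_cost c k"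
    unfolding algorithm_cost_def k(2) using prefix_cost_take[OF S kn] by simp
  ultimately show ?thesis using that ks kn by simp
qed

section \<open>Adversaries\<close>

text \<open>An adversary answers a query knowing only the list of variables queried before it;
  its own earlier answers are functions of that list.\<close>

definition follows :: "('v list \<Rightarrow> 'v \<Rightarrow> bool) \<Rightarrow> 'v list \<Rightarrow> 'v assignment \<Rightarrow> bool" where
  "follows adv L \<sigma> \<longleftrightarrow> (\<forall>ys x zs. L = ys @ x # zs \<longrightarrow> \<sigma> x = adv ys x)"

lemma follows_appendD: "follows adv (xs @ ys) \<sigma> \<Longrightarrow> follows adv xs \<sigma>"
  unfolding follows_def by (metis append_Cons append_assoc)

lemma follows_snoc: "follows adv (xs @ [x]) \<sigma> \<longleftrightarrow> follows adv xs \<sigma> \<and> \<sigma> x = adv xs x"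
proof
  assume "follows adv (xs @ [x]) \<sigma>"
  then show "follows adv xs \<sigma> \<and> \<sigma> x = adv xs x"
    using follows_appendD[of adv xs "[x]" \<sigma>] by (auto simp: follows_def)
next
  assume *: "follows adv xs \<sigma> \<and> \<sigma> x = adv xs x"
  show "follows adv (xs @ [x]) \<sigma>"
    unfolding follows_def
  proof (intro allI impI)
    fix ys y zs assume "xs @ [x] = ys @ y # zs"
    then show "\<sigma> y = adv ys y"
      using * unfolding follows_def by (cases zs rule: rev_cases) auto
  qed
qed

text \<open>Distinctness ensures that fixing a later answer does not overwrite an earlier
  one.\<close>

lemma ex_follows:
  assumes "distinct L"
  shows "\<exists>\<sigma>. follows adv L \<sigma>"
  using assms
proof (induction L rule: rev_induct)
  case Nil
  then show ?case by (simp add: follows_def)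
next
  case (snoc x xs)
  then obtain \<sigma> where \<sigma>: "follows adv xs \<sigma>" by auto
  have "follows adv xs (\<sigma>(x := adv xs x))"
    using \<sigma> snoc.prems unfolding follows_def by auto
  then show ?case by (auto simp: follows_snoc)
qed

text \<open>Induction on the tree, with \<open>xs\<close> the queries already answered. The unread
  variables \<open>ys\<close> are appended so that the adversary fixes the whole assignment, not
  only the part that was read.\<close>

lemma ex_adversary_run_aux:
  fixes A :: "'v::finite dtree"
  assumes "distinct xs" "\<And>\<sigma>. follows adv xs \<sigma> \<Longrightarrow> distinct (xs @ reads A \<sigma>)"
  shows "\<exists>\<sigma> ys. distinct (xs @ reads A \<sigma> @ ys) \<and> set (xs @ reads A \<sigma> @ ys) = UNIV \<and>
    follows adv (xs @ reads A \<sigma> @ ys) \<sigma>"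
  using assms
proof (induction A arbitrary: xs)
  case Stop
  obtain ys where "set ys = - set xs" "distinct ys"
    using finite_distinct_list[of "- set xs"] by auto
  then have *: "distinct (xs @ ys)" "set (xs @ ys) = UNIV" using Stop by auto
  then show ?case using ex_follows[OF *(1), of adv] by auto
next
  case (Query x t0 t1)
  define t where "t = (if adv xs x then t1 else t0)"
  have reads: "reads (Query x t0 t1) \<sigma> = x # reads t \<sigma>" if "\<sigma> x = adv xs x" for \<sigma>
    using that unfolding t_def by simp
  have d: "distinct (xs @ [x])"
    using ex_follows[OF Query.prems(1), of adv] Query.prems(2) by fastforce
  have d': "distinct ((xs @ [x]) @ reads t \<sigma>)" if "follows adv (xs @ [x]) \<sigma>" for \<sigma>
    using that Query.prems(2)[of \<sigma>] reads[of \<sigma>] by (simp add: follows_snoc)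
  have "\<exists>\<sigma> ys. distinct ((xs @ [x]) @ reads t \<sigma> @ ys) \<and>
      set ((xs @ [x]) @ reads t \<sigma> @ ys) = UNIV \<and> follows adv ((xs @ [x]) @ reads t \<sigma> @ ys) \<sigma>"
  proof (cases "adv xs x")
    case True
    then have "t = t1" by (simp add: t_def)
    with Query.IH(2)[OF d] d' show ?thesis by blast
  next
    case False
    then have "t = t0" by (simp add: t_def)
    with Query.IH(1)[OF d] d' show ?thesis by blast
  qed
  then obtain \<sigma> ys where *: "distinct ((xs @ [x]) @ reads t \<sigma> @ ys)"
      "set ((xs @ [x]) @ reads t \<sigma> @ ys) = UNIV" "follows adv ((xs @ [x]) @ reads t \<sigma> @ ys) \<sigma>"
    by blast
  have "\<sigma> x = adv xs x" using follows_appendD[OF *(3)] by (simp add: follows_snoc)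
  then have "reads (Query x t0 t1) \<sigma> = x # reads t \<sigma>" by (rule reads)
  then show ?case using * by (intro exI[of _ \<sigma>] exI[of _ ys]) auto
qed

lemma ex_adversary_run:
  fixes A :: "'v::finite dtree"
  assumes "evaluation_algorithm f A"
  obtains \<sigma> ys where "distinct (reads A \<sigma> @ ys)" "set (reads A \<sigma> @ ys) = UNIV"
    "follows adv (reads A \<sigma> @ ys) \<sigma>"
  using ex_adversary_run_aux[of "[]" adv A] assms unfolding evaluation_algorithm_def
  by auto

text \<open>Let \<open>z\<close> be the variable of \<open>K - P\<close> that is read last, and \<open>Q = insert z P\<close>. The adversary
  answers 0 to the first \<open>n - u\<close> queries in \<open>Q\<close> and 1 to the remaining ones, while every variable
  outside \<open>Q\<close> gets the value opposite to that of the last variable of \<open>Q\<close>. Then \<open>Q\<close> is a proof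
  and every proof contains the last variable of \<open>Q\<close>, which is also the last variable of \<open>K\<close>.
  The adversary does not know \<open>z\<close> in advance, but recognises it when it is queried.\<close>

lemma adversary_forces_reading:
  fixes A :: "'v::finite dtree"
  assumes alg: "evaluation_algorithm f A" and sym: "symmetric_fn f" and bl: "block f l u"
    and PK: "P \<subset> K" and cardP: "card P + 1 = l + (CARD('v) - u)"
  obtains \<sigma> z where "K \<subseteq> set (reads A \<sigma>)" "z \<in> K - P" "determines f \<sigma> (insert z P)"
proof -
  define r where "r = CARD('v) - u"
  \<comment> \<open>\<open>inQ\<close> and \<open>h\<close> use only the queries so far: a variable
    of \<open>K - P\<close> counts as \<open>z\<close> once no other element of \<open>K - P\<close>
    is left. They are later shown to express membership in \<open>Q\<close> and the number of
    earlier queries in \<open>Q\<close>.\<close>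
  define inQ where "inQ xs x \<longleftrightarrow> x \<in> P \<or> x \<in> K - P \<and> K - P \<subseteq> insert x (set xs)" for xs x
  define h where "h xs = card (P \<inter> set xs) + (if K - P \<subseteq> set xs then 1 else 0)" for xs
  \<comment> \<open>\<open>Q\<close> has \<open>l + r\<close> elements, so its last variable gets 1
    if \<open>l > 0\<close> and 0 if \<open>l = 0\<close>; thus \<open>l = 0\<close> is the opposite
    value.\<close>
  define adv where "adv xs x = (if inQ xs x then r \<le> h xs else l = 0)" for xs x
  obtain \<sigma> ws where d: "distinct (reads A \<sigma> @ ws)" and s: "set (reads A \<sigma> @ ws) = UNIV"
    and fo: "follows adv (reads A \<sigma> @ ws) \<sigma>"
    by (rule ex_adversary_run[OF alg])
  define L where "L = reads A \<sigma> @ ws"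
  have dL: "distinct L" and sL: "set L = UNIV" and fL: "follows adv L \<sigma>"
    using d s fo unfolding L_def by auto
  have "\<exists>x\<in>set L. x \<in> K - P" using PK sL by auto
  from split_list_last_prop[OF this] obtain as z bs where zL: "L = as @ z # bs" and z: "z \<in> K - P"
    and bs: "\<forall>x\<in>set bs. x \<notin> K - P"
    by blast
  define Q where "Q = insert z P"
  have cQ: "card Q = l + r" using z cardP unfolding Q_def r_def by simp
  \<comment> \<open>\<open>z\<close> is the last element of \<open>K - P\<close> in
    \<open>L\<close>, so a prefix of \<open>L\<close> exhausts \<open>K - P\<close> exactly when it
    contains \<open>z\<close>.\<close>
  have last: "K - P \<subseteq> set ys \<longleftrightarrow> z \<in> set ys" if "L = ys @ zs" for ys zs
  proof
    assume "z \<in> set ys"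
    then obtain ps qs where "ys = ps @ z # qs" by (meson split_list)
    then have L: "L = ps @ z # (qs @ zs)" using that by simp
    then have "z \<notin> set ps" "z \<notin> set (qs @ zs)" using dL by auto
    then have "ps = as" "qs @ zs = bs"
      using append_Cons_eq_iff[of z ps "qs @ zs" as bs] L zL by auto
    moreover have "x \<in> set as \<union> {z} \<union> set bs" for x using sL zL by auto
    ultimately show "K - P \<subseteq> set ys" using bs \<open>ys = ps @ z # qs\<close> by fastforce
  qed (use z in blast)
  have inQ: "inQ ys x \<longleftrightarrow> x \<in> Q" and h: "h ys = card (Q \<inter> set ys)" if "L = ys @ x # zs" for ys x zs
  proof -
    have x: "x \<notin> set ys" using dL that by simp
    have l1: "K - P \<subseteq> set ys \<longleftrightarrow> z \<in> set ys" using last[of ys "x # zs"] that by simp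
    have l2: "K - P \<subseteq> insert x (set ys) \<longleftrightarrow> z \<in> insert x (set ys)"
      using last[of "ys @ [x]" zs] that by simp
    show "inQ ys x \<longleftrightarrow> x \<in> Q"
      using l1 l2 x z unfolding inQ_def Q_def by blast
    show "h ys = card (Q \<inter> set ys)"
      using l1 z unfolding h_def Q_def by (simp add: Int_insert_left)
  qed
  have val: "\<sigma> x = (if x \<in> Q then r \<le> card (Q \<inter> set ys) else l = 0)" if "L = ys @ x # zs" for ys x zs
    using fL that inQ[OF that] h[OF that] unfolding follows_def adv_def by metis
  \<comment> \<open>Within \<open>Q\<close> the zeros come first, \<open>r\<close> of them, in every
    prefix of \<open>L\<close>; this is later applied to all of \<open>L\<close> and to the
    variables read.\<close>
  have zeros: "card {y \<in> Q \<inter> set ys. \<not> \<sigma> y} = min (card (Q \<inter> set ys)) r" if "L = ys @ zs" for ys zs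
    using that
  proof (induction ys arbitrary: zs rule: rev_induct)
    case (snoc x ys)
    have L: "L = ys @ x # zs" using snoc.prems by simp
    have x: "x \<notin> set ys" using dL L by simp
    have IH: "card {y \<in> Q \<inter> set ys. \<not> \<sigma> y} = min (card (Q \<inter> set ys)) r"
      by (rule snoc.IH[OF L])
    show ?case
    proof (cases "x \<in> Q")
      case True
      have "Q \<inter> set (ys @ [x]) = insert x (Q \<inter> set ys)" using True by auto
      then have c: "card (Q \<inter> set (ys @ [x])) = Suc (card (Q \<inter> set ys))" using x by simp
      show ?thesis
      proof (cases "\<sigma> x")
        case \<sigma>: True
        then have "{y \<in> Q \<inter> set (ys @ [x]). \<not> \<sigma> y} = {y \<in> Q \<inter> set ys. \<not> \<sigma> y}" by auto
        then show ?thesis using c IH val[OF L] True \<sigma> by simp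
      next
        case \<sigma>: False
        then have "{y \<in> Q \<inter> set (ys @ [x]). \<not> \<sigma> y} = insert x {y \<in> Q \<inter> set ys. \<not> \<sigma> y}"
          using True by auto
        then have "card {y \<in> Q \<inter> set (ys @ [x]). \<not> \<sigma> y} = Suc (card {y \<in> Q \<inter> set ys. \<not> \<sigma> y})"
          using x by simp
        then show ?thesis using c IH val[OF L] True \<sigma> by simp
      qed
    next
      case False
      then have "Q \<inter> set (ys @ [x]) = Q \<inter> set ys" by auto
      then show ?thesis using IH by simp
    qed
  qed simp
  have split: "card (Q \<inter> R) = card {x \<in> Q \<inter> R. \<sigma> x} + card {x \<in> Q \<inter> R. \<not> \<sigma> x}" for R
  proof -
    have "card (Q \<inter> R) = card ({x \<in> Q \<inter> R. \<sigma> x} \<union> {x \<in> Q \<inter> R. \<not> \<sigma> x})"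
      by (rule arg_cong[of _ _ card]) auto
    then show ?thesis by (simp add: card_Un_disjoint disjoint_iff)
  qed
  have Q0: "card {x \<in> Q. \<not> \<sigma> x} = r" using zeros[of L "[]"] sL cQ by simp
  then have Q1: "card {x \<in> Q. \<sigma> x} = l" using split[of UNIV] cQ by simp
  have out: "\<sigma> x = (l = 0)" if "x \<notin> Q" for x
  proof -
    obtain ys zs where "L = ys @ x # zs" using sL by (metis UNIV_I split_list)
    from val[OF this] show ?thesis using that by simp
  qed
  \<comment> \<open>The weight is an end of the block: \<open>u\<close> if \<open>l = 0\<close>,
    where only \<open>r\<close> variables are 0, and \<open>l\<close> otherwise.\<close>
  have \<sigma>: "card {x. \<sigma> x} \<in> {l..u}"
  proof (cases "l = 0")
    case True
    then have "{x. \<sigma> x} = - {x \<in> Q. \<not> \<sigma> x}" using out by auto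
    then have "card {x. \<sigma> x} = u"
      using Q0 blockD(2)[OF bl] unfolding r_def by (simp add: Compl_eq_Diff_UNIV card_Diff_subset)
    then show ?thesis using True by simp
  next
    case False
    then have "{x. \<sigma> x} = {x \<in> Q. \<sigma> x}" using out by auto
    then show ?thesis using Q1 blockD(1)[OF bl] by simp
  qed
  note crit = determines_iff_counts[OF sym bl \<sigma>, folded r_def]
  define R where "R = set (reads A \<sigma>)"
  have det: "determines f \<sigma> R"
    using alg unfolding evaluation_algorithm_def contains_proof_iff_determines R_def by blast
  have zR: "card {x \<in> Q \<inter> R. \<not> \<sigma> x} = min (card (Q \<inter> R)) r"
    unfolding R_def by (rule zeros[OF L_def])
  \<comment> \<open>The value of the last variable of \<open>Q\<close> occurs only inside
    \<open>Q\<close>, and a proof needs every occurrence of it. If these are ones, they follow all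
    \<open>r\<close> zeros of \<open>Q\<close>, so the zeros have been read too.\<close>
  have "l + r \<le> card (Q \<inter> R)"
  proof (cases "l = 0")
    case True
    then have "{x \<in> R. \<not> \<sigma> x} = {x \<in> Q \<inter> R. \<not> \<sigma> x}" using out by auto
    then show ?thesis using det crit zR True by simp
  next
    case False
    then have "{x \<in> R. \<sigma> x} = {x \<in> Q \<inter> R. \<sigma> x}" using out by auto
    then have "l \<le> card {x \<in> Q \<inter> R. \<sigma> x}" using det crit by simp
    then show ?thesis using split[of R] zR False by auto
  qed
  then have "Q \<inter> R = Q" using cQ by (intro card_seteq) auto
  then have "Q \<subseteq> R" by blast
  then have "K \<subseteq> R" using last[OF L_def] unfolding Q_def R_def by blast
  moreover have "determines f \<sigma> Q" using crit Q0 Q1 by simp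
  ultimately show ?thesis using that z unfolding Q_def R_def by blast
qed

lemma adversary_cost:
  fixes f :: "'v::finite assignment \<Rightarrow> bool"
  assumes alg: "evaluation_algorithm f A" and sym: "symmetric_fn f"
    and nonconst: "\<exists>\<sigma> \<tau>. f \<sigma> \<noteq> f \<tau>" and pos: "\<And>x. c x > 0"
    and k: "k \<in> {CARD('v) - spread f<..CARD('v)}"
  obtains \<sigma> where "prefix_cost c k \<le> algorithm_cost c A \<sigma>"
    "min_proof_cost f c \<sigma> \<le> prefix_cost c (CARD('v) - spread f) + sorted_cost c k"
proof -
  define m where "m = CARD('v) - spread f"
  have m: "m < k" "k \<le> CARD('v)" using k unfolding m_def by auto
  obtain l u where bl: "block f l u" and w: "u - l + 1 = spread f" by (rule ex_block_spread)
  have wn: "spread f \<le> CARD('v)" using block_width_le_card[OF sym nonconst bl] w by simp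
  obtain S where S: "distinct S" "set S = UNIV" "sorted (map c S)"
    by (rule ex_sorted_listing)
  have len: "length S = CARD('v)" by (rule length_listing[OF S(1,2)])
  define P K where "P = set (take m S)" and "K = set (take k S)"
  have cP: "card P = m" and cK: "card K = k"
    using S(1) m len unfolding P_def K_def by (simp_all add: distinct_card)
  have "P \<subseteq> K" unfolding P_def K_def using m by (intro set_take_subset_set_take) simp
  moreover have "P \<noteq> K" using cP cK m by auto
  ultimately have PK: "P \<subset> K" by blast
  \<comment> \<open>This is where the maximal width of the block is used: n - s + 1 = l + (n -
    u).\<close>
  have "card P + 1 = l + (CARD('v) - u)"
    using cP w wn blockD(1,2)[OF bl] unfolding m_def by simp
  from adversary_forces_reading[OF alg sym bl PK this]
  obtain \<sigma> z where \<sigma>: "K \<subseteq> set (reads A \<sigma>)" "z \<in> K - P" "determines f \<sigma> (insert z P)" .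
  have "prefix_cost c k = cost c K" unfolding K_def using prefix_cost_take[OF S m(2)] .
  also have "\<dots> \<le> algorithm_cost c A \<sigma>"
    unfolding algorithm_cost_def cost_def using \<sigma>(1) pos
    by (intro sum_mono2) (auto intro: less_imp_le)
  finally have 1: "prefix_cost c k \<le> algorithm_cost c A \<sigma>" .
  \<comment> \<open>Whichever \<open>z\<close> the algorithm reads last, it is among the
    \<open>k\<close> cheapest variables.\<close>
  have "c z \<le> sorted_cost c k"
    using sorted_listing_le(1)[OF S(3), of "k - 1" z] sorted_cost_nth[OF S, of k] m len \<sigma>(2)
    unfolding K_def by simp
  moreover have "cost c (insert z P) = c z + prefix_cost c m"
    using \<sigma>(2) prefix_cost_take[OF S, of m] m unfolding P_def cost_def by simp
  ultimately have "min_proof_cost f c \<sigma> \<le> prefix_cost c m + sorted_cost c k"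
    using min_proof_cost_le[of f \<sigma> "insert z P" c, OF \<sigma>(3) pos] by simp
  then show ?thesis using that 1 unfolding m_def by blast
qed

section \<open>The competitive ratio\<close>

lemma sorted_cost_pos:
  fixes c :: "'v::finite \<Rightarrow> real"
  assumes "\<And>x. c x > 0" "k \<in> {1..CARD('v)}"
  shows "0 < sorted_cost c k"
proof -
  obtain S where "distinct S" "set S = UNIV" "sorted (map c S)"
    by (rule ex_sorted_listing)
  from sorted_cost_nth[OF this assms(2)] show ?thesis using assms(1) by simp
qed

lemma prefix_cost_nonneg:
  fixes c :: "'v::finite \<Rightarrow> real"
  assumes "\<And>x. c x > 0" "k \<le> CARD('v)"
  shows "0 \<le> prefix_cost c k"
  unfolding prefix_cost_def using sorted_cost_pos[of c] assms
  by (intro sum_nonneg) (auto intro: less_imp_le)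

text \<open>A real infimum is informative only over a nonempty set. There are finitely many
  assignments and proof costs are positive, so the largest quotient is a bound.\<close>

lemma ex_ratio_bound:
  fixes f :: "'v::finite assignment \<Rightarrow> bool"
  assumes "symmetric_fn f" "\<exists>\<sigma> \<tau>. f \<sigma> \<noteq> f \<tau>" "\<And>x. c x > 0"
  shows "\<exists>\<rho>. \<forall>\<sigma>. algorithm_cost c A \<sigma> \<le> \<rho> * min_proof_cost f c \<sigma>"
proof -
  define g where "g \<sigma> = algorithm_cost c A \<sigma> / min_proof_cost f c \<sigma>" for \<sigma>
  have mp: "0 < min_proof_cost f c \<sigma>" for \<sigma> using assms by (rule min_proof_cost_pos)
  have "g \<sigma> \<le> Max (range g)" for \<sigma> by (intro Max_ge) auto
  then show ?thesis
    using mp unfolding g_def by (metis pos_divide_le_eq)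
qed

theorem theorem2:
  fixes f :: "('v::finite \<Rightarrow> bool) \<Rightarrow> bool"
    and c :: "'v \<Rightarrow> real"
    and n s :: nat
  assumes "n = CARD('v)"
    and "symmetric_fn f"
    and "\<exists>\<sigma> \<tau>. f \<sigma> \<noteq> f \<tau>"
    and "s = spread f"
    and "\<And>x. c x > 0"
  shows "competitive_ratio f c =
    (MAX k\<in>{n - s<..n}. prefix_cost c k / (prefix_cost c (n - s) + sorted_cost c k))"
proof -
  note sym = assms(2) and nonconst = assms(3) and pos = assms(5)
  define q where "q k = prefix_cost c k / (prefix_cost c (n - s) + sorted_cost c k)" for k
  define M where "M = Max (q ` {n - s<..n})"
  have den: "0 < prefix_cost c (n - s) + sorted_cost c k" if "k \<in> {n - s<..n}" for k
    using prefix_cost_nonneg[of c "n - s", OF pos] sorted_cost_pos[of c k, OF pos] that assms(1) by simp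
  have mp: "0 < min_proof_cost f c \<sigma>" for \<sigma> using sym nonconst pos by (rule min_proof_cost_pos)
  have qM: "q k \<le> M" if "k \<in> {n - s<..n}" for k
    unfolding M_def using that by (intro Max_ge) auto
  define bounds where "bounds A = {\<rho>. \<forall>\<sigma>. algorithm_cost c A \<sigma> \<le> \<rho> * min_proof_cost f c \<sigma>}" for A
  have "1 \<le> spread f" using block_width_le_spread ex_block_spread by (metis le_add2)
  then have ne: "{n - s<..n} \<noteq> {}" using assms(1,4) by simp
  have lower: "M \<le> \<rho>" if A: "evaluation_algorithm f A" and \<rho>: "\<rho> \<in> bounds A" for A \<rho>
  proof -
    have "q k \<le> \<rho>" if k: "k \<in> {n - s<..n}" for k
    proof -
      have "k \<in> {CARD('v) - spread f<..CARD('v)}" using k assms(1,4) by simp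
      then obtain \<sigma> where \<sigma>: "prefix_cost c k \<le> algorithm_cost c A \<sigma>"
        "min_proof_cost f c \<sigma> \<le> prefix_cost c (n - s) + sorted_cost c k"
        unfolding assms(1,4)
        by (rule adversary_cost[OF A sym nonconst, where c = c and k = k, OF pos])
      have 1: "algorithm_cost c A \<sigma> \<le> \<rho> * min_proof_cost f c \<sigma>"
        using \<rho> unfolding bounds_def by blast
      have "0 \<le> prefix_cost c k" using k assms(1) by (intro prefix_cost_nonneg pos) simp
      then have "0 \<le> \<rho> * min_proof_cost f c \<sigma>" using 1 \<sigma>(1) by linarith
      \<comment> \<open>The sign of \<open>\<rho>\<close> allows the proof cost to be replaced by
        its upper bound from the adversary.\<close>
      then have "0 \<le> \<rho>" using mp[of \<sigma>] by (simp add: zero_le_mult_iff)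
      then have "prefix_cost c k \<le> \<rho> * (prefix_cost c (n - s) + sorted_cost c k)"
        using 1 \<sigma> mult_left_mono[OF \<sigma>(2), of \<rho>] by linarith
      then show ?thesis unfolding q_def using den[OF k] by (simp add: pos_divide_le_eq)
    qed
    then show ?thesis unfolding M_def using ne by (intro Max.boundedI) auto
  qed
  have ratio: "M \<le> algorithm_ratio f c A" if "evaluation_algorithm f A" for A
    unfolding algorithm_ratio_def bounds_def[symmetric]
    using ex_ratio_bound[OF sym nonconst, where c = c and A = A, OF pos] lower[OF that]
    by (intro cInf_greatest) (auto simp: bounds_def)
  obtain S where S: "distinct S" "set S = UNIV" "sorted (map c S)"
    by (rule ex_sorted_listing)
  define A where "A = fixed_order_tree f S {} (\<lambda>_. False)"
  have A: "evaluation_algorithm f A"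
    unfolding A_def using S by (intro evaluation_algorithm_fixed_order_tree)
  \<comment> \<open>Each run of the sorted order stops at some \<open>k\<close>, where its ratio is
    at most \<open>q k\<close>; taking the maximum over \<open>k\<close> covers all
    assignments.\<close>
  have "M \<in> bounds A"
    unfolding bounds_def
  proof (intro CollectI allI)
    fix \<sigma>
    obtain k where k: "k \<in> {n - s<..n}" "algorithm_cost c A \<sigma> = prefix_cost c k"
      "prefix_cost c (n - s) + sorted_cost c k \<le> min_proof_cost f c \<sigma>"
      unfolding A_def assms(1,4)
      by (rule sorted_order_cost[OF sym nonconst, where c = c and S = S and \<sigma> = \<sigma>, OF pos S])
    have "0 \<le> q k"
      unfolding q_def using k(1) den[OF k(1)] assms(1)
      by (intro divide_nonneg_pos prefix_cost_nonneg pos) auto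
    have "prefix_cost c k = q k * (prefix_cost c (n - s) + sorted_cost c k)"
      unfolding q_def using den[OF k(1)] by simp
    also have "\<dots> \<le> q k * min_proof_cost f c \<sigma>"
      using k(3) \<open>0 \<le> q k\<close> by (rule mult_left_mono)
    also have "\<dots> \<le> M * min_proof_cost f c \<sigma>"
      using qM[OF k(1)] mp[of \<sigma>] by (intro mult_right_mono) auto
    finally show "algorithm_cost c A \<sigma> \<le> M * min_proof_cost f c \<sigma>" using k(2) by simp
  qed
  moreover have "bdd_below (bounds A)" using lower[OF A] by (meson bdd_below.I)
  ultimately have "algorithm_ratio f c A \<le> M"
    unfolding algorithm_ratio_def bounds_def[symmetric] by (intro cInf_lower)
  then have "algorithm_ratio f c A = M" using ratio[OF A] by simp
  \<comment> \<open>\<open>M\<close> bounds the ratios of all algorithms from below, which the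
    infimum over algorithms requires.\<close>
  moreover have "competitive_ratio f c \<le> algorithm_ratio f c A"
    unfolding competitive_ratio_def using A ratio
    by (intro cINF_lower bdd_belowI2[of _ M]) auto
  moreover have "M \<le> competitive_ratio f c"
    unfolding competitive_ratio_def using A ratio by (intro cINF_greatest) auto
  ultimately show ?thesis unfolding M_def q_def by simp
qed

end
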